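(* $\mathsf{EFA}\nvdash \mathsf{BL}_{d\mapsto 2^d}$. In particular, $\mathsf{RCA}_0^*$ does not prove the finite version of Brown's lemma, i.e. the statement ``for every $f\colon\mathbb{N}\to\mathbb{N}$, $\mathsf{BL}_f$''.
   Context: $\mathsf{EFA}$ (Elementary Function Arithmetic) is the first-order theory $\mathsf{I}\Sigma_0+\exp$. $\mathsf{RCA}_0^*$ is the system of second-order arithmetic consisting of the usual basic axioms for addition, multiplication and exponentiation, together with $\Sigma^0_0$-induction and $\Delta^0_1$-comprehension. For $f\colon\mathbb{N}\to\mathbb{N}$, $\mathsf{BL}_f$ is the statement: for all $r>0$ there exists $n$ such that every coloring $C\colon n\to r$ has a $C$-homogeneous set $H$ such that $|H|>f(\mathrm{gs}(H))$. Here a natural number $n$ is identified with $\{0,\dots,n-1\}$, finite sets and finite colorings are coded by numbers (so that for $f(d)=2^d$ the statement $\mathsf{BL}_f$ is a sentence of first-order arithmetic), a set $H\subseteq n$ is $C$-homogeneous if $C$ is constant on $H$, and the gap size $\mathrm{gs}(H)$ of a finite set $H$ is the largest difference between two consecutive elements of $H$, with $\mathrm{gs}(H)=1$ if $|H|\leq 1$. *)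

theory Defs
  imports Main
begin

section \<open>The language of second-order arithmetic with exponentiation\<close>

text \<open>
  Both theories live in the two-sorted language with symbols
  \<open>0, 1, +, \<cdot>, exp, <, =, \<in>\<close>, where \<open>exp(m,n) = m ^ n\<close> is a binary function symbol.
  Number variables and set variables carry separate de Bruijn indices:
  \<open>NAll\<close> binds number variable \<open>0\<close> and \<open>SAll\<close> binds set variable \<open>0\<close>.
  In \<open>t \<^bold>\<in> X\<close> the second argument is the index of a set variable. Equality is primitive for
  numbers only.
\<close>

datatype tm =
    Var nat
  | Zero
  | One
  | Add tm tm (infixl "\<^bold>+" 85)
  | Mul tm tm (infixl "\<^bold>*" 90)
  | Exp tm tm (infixr "\<^bold>^" 95)

datatype fm =
    Bot
  | Eq tm tm (infix "\<^bold>=" 80)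
  | Less tm tm (infix "\<^bold><" 80)
  | Mem tm nat (infix "\<^bold>\<in>" 80)
  | Imp fm fm (infixr "\<^bold>\<longrightarrow>" 55)
  | NAll fm
  | SAll fm

definition Neg :: "fm \<Rightarrow> fm" ("\<^bold>\<not> _" [75] 75) where
  "\<^bold>\<not> \<phi> = (\<phi> \<^bold>\<longrightarrow> Bot)"

definition Con :: "fm \<Rightarrow> fm \<Rightarrow> fm" (infixr "\<^bold>\<and>" 70) where
  "\<phi> \<^bold>\<and> \<psi> = \<^bold>\<not> (\<phi> \<^bold>\<longrightarrow> \<^bold>\<not> \<psi>)"

definition Dis :: "fm \<Rightarrow> fm \<Rightarrow> fm" (infixr "\<^bold>\<or>" 65) where
  "\<phi> \<^bold>\<or> \<psi> = (\<^bold>\<not> \<phi> \<^bold>\<longrightarrow> \<psi>)"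

definition Iff :: "fm \<Rightarrow> fm \<Rightarrow> fm" (infix "\<^bold>\<longleftrightarrow>" 50) where
  "(\<phi> \<^bold>\<longleftrightarrow> \<psi>) = ((\<phi> \<^bold>\<longrightarrow> \<psi>) \<^bold>\<and> (\<psi> \<^bold>\<longrightarrow> \<phi>))"

definition NEx :: "fm \<Rightarrow> fm" where
  "NEx \<phi> = \<^bold>\<not> NAll (\<^bold>\<not> \<phi>)"

definition SEx :: "fm \<Rightarrow> fm" where
  "SEx \<phi> = \<^bold>\<not> SAll (\<^bold>\<not> \<phi>)"

primrec tsubst :: "(nat \<Rightarrow> tm) \<Rightarrow> tm \<Rightarrow> tm" where
  "tsubst \<sigma> (Var i) = \<sigma> i"
| "tsubst \<sigma> Zero = Zero"
| "tsubst \<sigma> One = One"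
| "tsubst \<sigma> (s \<^bold>+ t) = tsubst \<sigma> s \<^bold>+ tsubst \<sigma> t"
| "tsubst \<sigma> (s \<^bold>* t) = tsubst \<sigma> s \<^bold>* tsubst \<sigma> t"
| "tsubst \<sigma> (s \<^bold>^ t) = tsubst \<sigma> s \<^bold>^ tsubst \<sigma> t"

definition tlift :: "tm \<Rightarrow> tm" where
  "tlift = tsubst (\<lambda>i. Var (Suc i))"

text \<open>Simultaneous substitution of terms for the free number variables.\<close>

primrec subst :: "(nat \<Rightarrow> tm) \<Rightarrow> fm \<Rightarrow> fm" where
  "subst \<sigma> Bot = Bot"
| "subst \<sigma> (s \<^bold>= t) = (tsubst \<sigma> s \<^bold>= tsubst \<sigma> t)"
| "subst \<sigma> (s \<^bold>< t) = (tsubst \<sigma> s \<^bold>< tsubst \<sigma> t)"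
| "subst \<sigma> (t \<^bold>\<in> X) = (tsubst \<sigma> t \<^bold>\<in> X)"
| "subst \<sigma> (\<phi> \<^bold>\<longrightarrow> \<psi>) = (subst \<sigma> \<phi> \<^bold>\<longrightarrow> subst \<sigma> \<psi>)"
| "subst \<sigma> (NAll \<phi>) = NAll (subst (case_nat (Var 0) (\<lambda>i. tlift (\<sigma> i))) \<phi>)"
| "subst \<sigma> (SAll \<phi>) = SAll (subst \<sigma> \<phi>)"

text \<open>Simultaneous renaming of the free set variables.\<close>

primrec srename :: "(nat \<Rightarrow> nat) \<Rightarrow> fm \<Rightarrow> fm" where
  "srename \<rho> Bot = Bot"
| "srename \<rho> (s \<^bold>= t) = (s \<^bold>= t)"
| "srename \<rho> (s \<^bold>< t) = (s \<^bold>< t)"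
| "srename \<rho> (t \<^bold>\<in> X) = (t \<^bold>\<in> \<rho> X)"
| "srename \<rho> (\<phi> \<^bold>\<longrightarrow> \<psi>) = (srename \<rho> \<phi> \<^bold>\<longrightarrow> srename \<rho> \<psi>)"
| "srename \<rho> (NAll \<phi>) = NAll (srename \<rho> \<phi>)"
| "srename \<rho> (SAll \<phi>) = SAll (srename (case_nat 0 (\<lambda>X. Suc (\<rho> X))) \<phi>)"

definition lift :: "fm \<Rightarrow> fm" where
  "lift = subst (\<lambda>i. Var (Suc i))"

definition slift :: "fm \<Rightarrow> fm" where
  "slift = srename Suc"

definition inst :: "tm \<Rightarrow> fm \<Rightarrow> fm" where
  "inst t = subst (case_nat t Var)"

definition sinst :: "nat \<Rightarrow> fm \<Rightarrow> fm" where
  "sinst X = srename (case_nat X (\<lambda>Y. Y))"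

definition NBAll :: "tm \<Rightarrow> fm \<Rightarrow> fm" where
  "NBAll t \<phi> = NAll (Var 0 \<^bold>< tlift t \<^bold>\<longrightarrow> \<phi>)"

definition NBEx :: "tm \<Rightarrow> fm \<Rightarrow> fm" where
  "NBEx t \<phi> = NEx (Var 0 \<^bold>< tlift t \<^bold>\<and> \<phi>)"

text \<open>The formulas of first-order arithmetic: no set variables and no set quantifiers.\<close>

primrec first_order :: "fm \<Rightarrow> bool" where
  "first_order Bot = True"
| "first_order (s \<^bold>= t) = True"
| "first_order (s \<^bold>< t) = True"
| "first_order (t \<^bold>\<in> X) = False"
| "first_order (\<phi> \<^bold>\<longrightarrow> \<psi>) = (first_order \<phi> \<and> first_order \<psi>)"
| "first_order (NAll \<phi>) = first_order \<phi>"
| "first_order (SAll \<phi>) = False"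

text \<open>
  \<open>\<Sigma>\<^sup>0\<^sub>0\<close> formulas: number quantifiers are bounded by arbitrary terms (including exponential ones),
  there are no set quantifiers, and free set variables are allowed.
\<close>

inductive sigma00 :: "fm \<Rightarrow> bool" where
  "sigma00 Bot"
| "sigma00 (s \<^bold>= t)"
| "sigma00 (s \<^bold>< t)"
| "sigma00 (t \<^bold>\<in> X)"
| "sigma00 \<phi> \<Longrightarrow> sigma00 \<psi> \<Longrightarrow> sigma00 (\<phi> \<^bold>\<longrightarrow> \<psi>)"
| "sigma00 \<phi> \<Longrightarrow> sigma00 (NBAll t \<phi>)"
| "sigma00 \<phi> \<Longrightarrow> sigma00 (NBEx t \<phi>)"

definition sigma01 :: "fm \<Rightarrow> bool" where
  "sigma01 \<phi> \<longleftrightarrow> (\<exists>\<theta>. sigma00 \<theta> \<and> \<phi> = NEx \<theta>)"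

definition pi01 :: "fm \<Rightarrow> bool" where
  "pi01 \<phi> \<longleftrightarrow> (\<exists>\<theta>. sigma00 \<theta> \<and> \<phi> = NAll \<theta>)"


section \<open>Provability\<close>

text \<open>
  A Hilbert calculus for classical (two-sorted) predicate logic with equality. The parameter \<open>L\<close> is
  the set of formulas that may occur in a derivation; with \<open>L = first_order\<close> the set rules never
  apply and the calculus is ordinary first-order logic. Because of the generalization rules,
  an open formula in \<open>T\<close> has the same effect as its universal closure.
\<close>

inductive logical_axiom :: "fm \<Rightarrow> bool" where
  "logical_axiom (\<phi> \<^bold>\<longrightarrow> \<psi> \<^bold>\<longrightarrow> \<phi>)"
| "logical_axiom ((\<phi> \<^bold>\<longrightarrow> \<psi> \<^bold>\<longrightarrow> \<chi>) \<^bold>\<longrightarrow> (\<phi> \<^bold>\<longrightarrow> \<psi>) \<^bold>\<longrightarrow> \<phi> \<^bold>\<longrightarrow> \<chi>)"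
| "logical_axiom (((\<phi> \<^bold>\<longrightarrow> Bot) \<^bold>\<longrightarrow> Bot) \<^bold>\<longrightarrow> \<phi>)"
| "logical_axiom (NAll \<phi> \<^bold>\<longrightarrow> inst t \<phi>)"
| "logical_axiom (NAll (lift \<phi> \<^bold>\<longrightarrow> \<psi>) \<^bold>\<longrightarrow> \<phi> \<^bold>\<longrightarrow> NAll \<psi>)"
| "logical_axiom (SAll \<phi> \<^bold>\<longrightarrow> sinst X \<phi>)"
| "logical_axiom (SAll (slift \<phi> \<^bold>\<longrightarrow> \<psi>) \<^bold>\<longrightarrow> \<phi> \<^bold>\<longrightarrow> SAll \<psi>)"
| "logical_axiom (t \<^bold>= t)"
| "logical_axiom (s \<^bold>= t \<^bold>\<longrightarrow> inst s \<phi> \<^bold>\<longrightarrow> inst t \<phi>)"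

inductive provable :: "(fm \<Rightarrow> bool) \<Rightarrow> fm set \<Rightarrow> fm \<Rightarrow> bool" for L T where
  Logical: "logical_axiom \<phi> \<Longrightarrow> L \<phi> \<Longrightarrow> provable L T \<phi>"
| Axiom: "\<phi> \<in> T \<Longrightarrow> L \<phi> \<Longrightarrow> provable L T \<phi>"
| MP: "provable L T (\<phi> \<^bold>\<longrightarrow> \<psi>) \<Longrightarrow> provable L T \<phi> \<Longrightarrow> provable L T \<psi>"
| NGen: "provable L T \<phi> \<Longrightarrow> L (NAll \<phi>) \<Longrightarrow> provable L T (NAll \<phi>)"
| SGen: "provable L T \<phi> \<Longrightarrow> L (SAll \<phi>) \<Longrightarrow> provable L T (SAll \<phi>)"


section \<open>The theories\<close>

definition basic_axioms :: "fm set" where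
  "basic_axioms =
    {\<^bold>\<not> Var 0 \<^bold>+ One \<^bold>= Zero,
     Var 0 \<^bold>+ One \<^bold>= Var 1 \<^bold>+ One \<^bold>\<longrightarrow> Var 0 \<^bold>= Var 1,
     Var 0 \<^bold>+ Zero \<^bold>= Var 0,
     Var 0 \<^bold>+ (Var 1 \<^bold>+ One) \<^bold>= (Var 0 \<^bold>+ Var 1) \<^bold>+ One,
     Var 0 \<^bold>* Zero \<^bold>= Zero,
     Var 0 \<^bold>* (Var 1 \<^bold>+ One) \<^bold>= Var 0 \<^bold>* Var 1 \<^bold>+ Var 0,
     Var 0 \<^bold>^ Zero \<^bold>= One,
     Var 0 \<^bold>^ (Var 1 \<^bold>+ One) \<^bold>= Var 0 \<^bold>^ Var 1 \<^bold>* Var 0,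
     \<^bold>\<not> Var 0 \<^bold>< Zero,
     Var 0 \<^bold>< Var 1 \<^bold>+ One \<^bold>\<longleftrightarrow> Var 0 \<^bold>< Var 1 \<^bold>\<or> Var 0 \<^bold>= Var 1}"

text \<open>\<open>\<phi>(0) \<and> \<forall>n (\<phi>(n) \<rightarrow> \<phi>(n + 1)) \<rightarrow> \<forall>n \<phi>(n)\<close>, where \<open>n\<close> is number variable \<open>0\<close> of \<open>\<phi>\<close> and the
  remaining free variables are parameters.\<close>

definition induction_axiom :: "fm \<Rightarrow> fm" where
  "induction_axiom \<phi> =
    (inst Zero \<phi> \<^bold>\<and> NAll (\<phi> \<^bold>\<longrightarrow> subst (case_nat (Var 0 \<^bold>+ One) (\<lambda>i. Var (Suc i))) \<phi>)
      \<^bold>\<longrightarrow> NAll \<phi>)"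

text \<open>\<open>\<forall>n (\<phi>(n) \<leftrightarrow> \<psi>(n)) \<rightarrow> \<exists>X \<forall>n (n \<in> X \<leftrightarrow> \<phi>(n))\<close>; the lifting ensures that \<open>X\<close> is not free
  in \<open>\<phi>\<close>.\<close>

definition comprehension_axiom :: "fm \<Rightarrow> fm \<Rightarrow> fm" where
  "comprehension_axiom \<phi> \<psi> =
    (NAll (\<phi> \<^bold>\<longleftrightarrow> \<psi>) \<^bold>\<longrightarrow> SEx (NAll (Var 0 \<^bold>\<in> 0 \<^bold>\<longleftrightarrow> slift \<phi>)))"

text \<open>
  \<open>EFA\<close>, that is \<open>I\<Sigma>\<^sub>0 + exp\<close>, is presented with \<open>exp\<close> as a function symbol, its recursion equations, and
  induction for bounded formulas of the extended language. This is the usual definitional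
  extension of the presentation in which \<open>exp\<close> states the totality of a bounded formula defining
  \<open>m ^ n = k\<close>, and it matches the language of \<open>RCA0_star\<close>.
\<close>

definition EFA :: "fm set" where
  "EFA = basic_axioms \<union> {induction_axiom \<phi> | \<phi>. sigma00 \<phi> \<and> first_order \<phi>}"

definition RCA0_star :: "fm set" where
  "RCA0_star =
    basic_axioms
    \<union> {induction_axiom \<phi> | \<phi>. sigma00 \<phi>}
    \<union> {comprehension_axiom \<phi> \<psi> | \<phi> \<psi>. sigma01 \<phi> \<and> pi01 \<psi>}"

definition EFA_proves :: "fm \<Rightarrow> bool" where
  "EFA_proves = provable first_order EFA"

definition RCA0_star_proves :: "fm \<Rightarrow> bool" where
  "RCA0_star_proves = provable (\<lambda>_. True) RCA0_star"


section \<open>Coding of finite sets and functions\<close>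

text \<open>
  The term arguments of the following formulas live in the ambient context; every definition
  lifts them past the quantifiers it introduces.
\<close>

abbreviation tlift2 :: "tm \<Rightarrow> tm" where
  "tlift2 t \<equiv> tlift (tlift t)"

abbreviation tlift3 :: "tm \<Rightarrow> tm" where
  "tlift3 t \<equiv> tlift (tlift (tlift t))"

definition Two :: tm where
  "Two = One \<^bold>+ One"

text \<open>\<open>\<exists>!x < t. \<phi>(x)\<close>, as \<open>\<exists>x < t. (\<phi>(x) \<and> \<forall>y < t. (\<phi>(y) \<rightarrow> y = x))\<close>.\<close>

definition NBEx1 :: "tm \<Rightarrow> fm \<Rightarrow> fm" where
  "NBEx1 t \<phi> = NBEx t (\<phi> \<^bold>\<and>
     NBAll (tlift t)
       (subst (case_nat (Var 0) (\<lambda>i. Var (i + 2))) \<phi> \<^bold>\<longrightarrow> Var 0 \<^bold>= Var 1))"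

text \<open>The finite set coded by \<open>u\<close> consists of the positions of the digits \<open>1\<close> in the binary
  expansion of \<open>u\<close>: \<open>t\<close> belongs to it iff \<open>u = (2q + 1) \<cdot> 2 ^ t + s\<close> for some \<open>q\<close> and \<open>s < 2 ^ t\<close>.
  Such a \<open>q\<close> is smaller than \<open>u\<close>.\<close>

definition elem :: "tm \<Rightarrow> tm \<Rightarrow> fm" where
  "elem t u =
    NBEx u (NBEx (Two \<^bold>^ tlift t)
      (tlift2 u \<^bold>= (Two \<^bold>* Var 1 \<^bold>+ One) \<^bold>* Two \<^bold>^ tlift2 t \<^bold>+ Var 0))"

text \<open>Quantification over the elements of a coded set; these are smaller than the code.\<close>

definition AllIn :: "tm \<Rightarrow> fm \<Rightarrow> fm" where
  "AllIn u \<phi> = NBAll u (elem (Var 0) (tlift u) \<^bold>\<longrightarrow> \<phi>)"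

definition ExIn :: "tm \<Rightarrow> fm \<Rightarrow> fm" where
  "ExIn u \<phi> = NBEx u (elem (Var 0) (tlift u) \<^bold>\<and> \<phi>)"

text \<open>The injective pairing function \<open>(i, j) \<mapsto> (i + j)\<^sup>2 + i\<close>.\<close>

definition pair :: "tm \<Rightarrow> tm \<Rightarrow> tm" where
  "pair s t = (s \<^bold>+ t) \<^bold>^ Two \<^bold>+ s"

text \<open>\<open>c\<close> codes (the graph of) a function from \<open>{0, \<dots>, m - 1}\<close> to \<open>{0, \<dots>, r - 1}\<close>.\<close>

definition fin_fun :: "tm \<Rightarrow> tm \<Rightarrow> tm \<Rightarrow> fm" where
  "fin_fun c m r =
    (AllIn c (NBEx (tlift m) (NBEx (tlift2 r) (Var 2 \<^bold>= pair (Var 1) (Var 0)))) \<^bold>\<and>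
     NBAll m (NBEx1 (tlift r) (elem (pair (Var 1) (Var 0)) (tlift2 c))))"

definition fin_subset :: "tm \<Rightarrow> tm \<Rightarrow> fm" where
  "fin_subset h n = AllIn h (Var 0 \<^bold>< tlift n)"

text \<open>\<open>|h| = k\<close>: some \<open>p\<close> codes a bijection from \<open>{0, \<dots>, k - 1}\<close> onto the set coded by \<open>h\<close>.
  The codomain \<open>{0, \<dots>, h - 1}\<close> in \<open>fin_fun\<close> is large enough to contain that set.\<close>

definition has_card :: "tm \<Rightarrow> tm \<Rightarrow> fm" where
  "has_card h k =
    NEx (fin_fun (Var 0) (tlift k) (tlift h) \<^bold>\<and>
      NBAll (tlift k) (NBAll (tlift2 h)
        (elem (pair (Var 1) (Var 0)) (Var 2) \<^bold>\<longrightarrow> elem (Var 0) (tlift3 h))) \<^bold>\<and>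
      AllIn (tlift h) (NBEx1 (tlift2 k) (elem (pair (Var 0) (Var 1)) (Var 2))))"

text \<open>\<open>x\<close> and \<open>y\<close>, elements of the set coded by \<open>h\<close>, are consecutive in it.\<close>

definition consecutive :: "tm \<Rightarrow> tm \<Rightarrow> tm \<Rightarrow> fm" where
  "consecutive h x y =
    (x \<^bold>< y \<^bold>\<and> AllIn h (\<^bold>\<not> (tlift x \<^bold>< Var 0 \<^bold>\<and> Var 0 \<^bold>< tlift y)))"

text \<open>\<open>gs(h) = g\<close>. The first disjunct is the case \<open>|h| \<le> 1\<close>; the second one expresses that \<open>g\<close> is
  the maximum of the differences of consecutive elements, so it entails \<open>|h| \<ge> 2\<close>.\<close>

definition has_gap_size :: "tm \<Rightarrow> tm \<Rightarrow> fm" where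
  "has_gap_size h g =
    ((AllIn h (AllIn (tlift h) (Var 0 \<^bold>= Var 1)) \<^bold>\<and> g \<^bold>= One) \<^bold>\<or>
     (ExIn h (ExIn (tlift h)
        (consecutive (tlift2 h) (Var 1) (Var 0) \<^bold>\<and> Var 0 \<^bold>= Var 1 \<^bold>+ tlift2 g)) \<^bold>\<and>
      AllIn h (AllIn (tlift h)
        (consecutive (tlift2 h) (Var 1) (Var 0) \<^bold>\<longrightarrow>
           Var 0 \<^bold>< Var 1 \<^bold>+ tlift2 g \<^bold>+ One))))"

text \<open>The function coded by \<open>c\<close>, with values below \<open>r\<close>, is constant on the set coded by \<open>h\<close>
  (for \<open>r > 0\<close>).\<close>

definition homogeneous :: "tm \<Rightarrow> tm \<Rightarrow> tm \<Rightarrow> fm" where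
  "homogeneous c r h =
    NBEx r (AllIn (tlift h) (elem (pair (Var 0) (Var 1)) (tlift2 c)))"


section \<open>Brown's lemma\<close>

text \<open>
  \<open>f_less d k\<close> is a formula expressing \<open>f(d) < k\<close>. Reading the binders from the outside:
  \<open>\<forall>r > 0. \<exists>n. \<forall>C. C : n \<rightarrow> r \<longrightarrow> (\<exists>H \<subseteq> n. H is C-homogeneous \<and> (\<exists>k g. |H| = k \<and> gs(H) = g \<and> f(g) < k))\<close>.
\<close>

definition BL :: "(tm \<Rightarrow> tm \<Rightarrow> fm) \<Rightarrow> fm" where
  "BL f_less =
    NAll (Zero \<^bold>< Var 0 \<^bold>\<longrightarrow>
      NEx (NAll (fin_fun (Var 0) (Var 1) (Var 2) \<^bold>\<longrightarrow>
        NEx (fin_subset (Var 0) (Var 2) \<^bold>\<and>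
             homogeneous (Var 1) (Var 3) (Var 0) \<^bold>\<and>
             NEx (NEx (has_card (Var 2) (Var 1) \<^bold>\<and>
                       has_gap_size (Var 2) (Var 0) \<^bold>\<and>
                       f_less (Var 0) (Var 1)))))))"

definition BL_exp2 :: fm where
  "BL_exp2 = BL (\<lambda>d k. Two \<^bold>^ d \<^bold>< k)"

text \<open>Set variable \<open>X\<close> is (the graph of) a function from the numbers to the numbers.\<close>

definition is_function :: "nat \<Rightarrow> fm" where
  "is_function X =
    (NAll (Var 0 \<^bold>\<in> X \<^bold>\<longrightarrow> NEx (NEx (Var 2 \<^bold>= pair (Var 1) (Var 0)))) \<^bold>\<and>
     NAll (NEx (pair (Var 1) (Var 0) \<^bold>\<in> X \<^bold>\<and>
       NAll (pair (Var 2) (Var 0) \<^bold>\<in> X \<^bold>\<longrightarrow> Var 0 \<^bold>= Var 1))))"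

text \<open>For every \<open>f : \<nat> \<rightarrow> \<nat>\<close>, \<open>BL\<^sub>f\<close>.\<close>

definition finite_brown :: fm where
  "finite_brown =
    SAll (is_function 0 \<^bold>\<longrightarrow>
      BL (\<lambda>d k. NEx (pair (tlift d) (Var 0) \<^bold>\<in> 0 \<^bold>\<and> Var 0 \<^bold>< tlift k)))"

end

theory Submission
  imports Defs "HOL-Library.Nat_Bijection"
begin

text \<open>
  Both parts follow from one model of \<open>RCA0_star\<close> in which \<open>BL_exp2\<close> and \<open>finite_brown\<close> fail; it is
  also a model of \<open>EFA\<close>, whose axioms are among those of \<open>RCA0_star\<close>.

  The combinatorial reason is that Brown numbers grow too fast. Let \<open>m\<close> be the length of a
  colouring with \<open>r\<close> colours in which every homogeneous set \<open>H\<close> has at most \<open>2 ^ gs(H)\<close> elements.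
  Repeating it in consecutive blocks of length \<open>m\<close> and using \<open>r\<close> fresh colours in every other
  block gives a colouring with \<open>2r\<close> colours. A homogeneous set with gaps at most \<open>m\<close> cannot leave its
  block, while one with a larger gap size may have \<open>2 ^ (m + 1)\<close> elements, so that the length can be
  increased to \<open>2 ^ (m + 1)\<close>. Iterating, \<open>2 ^ j\<close> colours need a length above a tower of exponentials of
  height \<open>j\<close> (\<open>block_colour_homogeneous_small\<close>).

  On the logical side, \<open>EFA\<close> can only prove the totality of functions of elementary growth. Instead
  of proving this in general, the argument builds a model that is tailored to the function above. Its
  numbers are the functions \<open>f\<close> on the natural numbers with \<open>f x \<le> tower (x + k)\<close> for some constant
  \<open>k\<close> and almost all \<open>x\<close>, where ``almost all'' refers to a free ultrafilter. They form an initial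
  segment of the ultrapower that is closed under exponentiation. A bounded formula is true in the
  model iff it holds in the standard model at almost all \<open>x\<close> (\<open>sigma00_transfers\<close>), because the
  witnesses of bounded quantifiers stay in the segment. This gives bounded induction. The sets are
  all families \<open>A\<close> of sets of natural numbers, with \<open>f \<in> A\<close> meaning \<open>f x \<in> A x\<close> for almost all \<open>x\<close>;
  comparing least witnesses of the two unbounded formulas yields \<open>\<Delta>\<^sup>0\<^sub>1\<close> comprehension
  (\<open>comprehension_axiom_valid\<close>).

  In this model take \<open>r x = 2 ^ (2x)\<close> colours. Every \<open>n\<close> in the segment satisfies
  \<open>n x \<le> tower (x + k) \<le> tower (2x)\<close> for almost all \<open>x\<close>, and up to \<open>tower (2x)\<close> there is a colouring
  with \<open>2 ^ (2x)\<close> colours that has only small homogeneous sets (\<open>BL_fails\<close>).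
\<close>

section \<open>Colourings whose homogeneous sets are small\<close>

fun tower :: "nat \<Rightarrow> nat" where
  "tower 0 = 1"
| "tower (Suc j) = 2 ^ (tower j + 1)"

text \<open>The lowest binary digit of a colour is the parity of the block of length \<open>tower j\<close>; the other
  digits are the colour within the block.\<close>

fun block_colour :: "nat \<Rightarrow> nat \<Rightarrow> nat" where
  "block_colour 0 x = 0"
| "block_colour (Suc j) x = 2 * block_colour j (x mod tower j) + (x div tower j) mod 2"

text \<open>For finite \<open>H\<close> with at least two elements this says that the gap size is at most \<open>d\<close>. It is also
  true of smaller sets, whatever \<open>d\<close> is.\<close>

definition gaps_le :: "nat \<Rightarrow> nat set \<Rightarrow> bool" where
  "gaps_le d H \<longleftrightarrow>
    (\<forall>x\<in>H. \<forall>y\<in>H. x < y \<and> (\<forall>z\<in>H. \<not> (x < z \<and> z < y)) \<longrightarrow> y \<le> x + d)"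

lemma tower_pos: "0 < tower j"
  by (cases j) auto

lemma tower_less_Suc: "tower j < tower (Suc j)"
proof -
  have "tower j < 2 ^ tower j" by (rule less_exp)
  also have "\<dots> \<le> tower (Suc j)" by simp
  finally show ?thesis .
qed

lemma tower_mono: "i \<le> j \<Longrightarrow> tower i \<le> tower j"
  by (rule lift_Suc_mono_le[of tower]) (rule less_imp_le[OF tower_less_Suc])

lemma le_tower: "n \<le> tower n"
proof (induction n)
  case (Suc n)
  then show ?case by (intro Suc_leI le_less_trans[OF _ tower_less_Suc])
qed simp

lemma block_colour_less: "block_colour j x < 2 ^ j"
proof (induction j arbitrary: x)
  case (Suc j)
  have "block_colour j (x mod tower j) + 1 \<le> 2 ^ j" using Suc.IH[of "x mod tower j"] by simp
  moreover have "(x div tower j) mod 2 < 2" by simp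
  ultimately show ?case unfolding block_colour.simps power_Suc by linarith
qed simp

text \<open>A step of length at most \<open>m\<close> leads to the same or to the next block of length \<open>m\<close>, and adjacent
  blocks differ in parity. So a set whose elements lie in blocks of one parity stays in its block
  along the chain of its consecutive elements.\<close>

lemma gapped_homogeneous_in_one_block:
  assumes gaps: "gaps_le d H" and "d \<le> m" and "0 < m"
    and parity: "\<forall>x\<in>H. (x div m) mod 2 = p"
    and "x \<in> H" "y \<in> H" "x \<le> y"
  shows "y div m = x div m"
  using \<open>y \<in> H\<close> \<open>x \<le> y\<close>
proof (induction y rule: less_induct)
  case (less y)
  show ?case
  proof (cases "x = y")
    case False
    define z where "z = Max {z \<in> H. z < y}"
    have fin: "finite {z \<in> H. z < y}" by simp
    have ne: "x \<in> {z \<in> H. z < y}" using False less.prems \<open>x \<in> H\<close> by simp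
    have z: "z \<in> H" "z < y" using Max_in[OF fin] ne unfolding z_def by blast+
    have "x \<le> z" unfolding z_def using fin ne by (rule Max_ge)
    have "\<forall>w\<in>H. \<not> (z < w \<and> w < y)"
    proof (intro ballI notI)
      fix w assume "w \<in> H" "z < w \<and> w < y"
      then have "w \<le> z" unfolding z_def using fin by (intro Max_ge) auto
      with \<open>z < w \<and> w < y\<close> show False by simp
    qed
    then have "y \<le> z + d" using gaps z less.prems(1) unfolding gaps_le_def by blast
    then have "y \<le> z + m" using \<open>d \<le> m\<close> by simp
    then have "y div m \<le> (z + m) div m" by (rule div_le_mono)
    also have "(z + m) div m = z div m + 1" using \<open>0 < m\<close> by (intro div_add_self2) blast
    finally have "y div m \<le> z div m + 1" .
    moreover have "z div m \<le> y div m" using z by (intro div_le_mono) simp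
    moreover have "(y div m) mod 2 = (z div m) mod 2" using parity z less.prems by simp
    moreover have "b = c" if "b \<le> c + 1" "c \<le> b" "b mod 2 = c mod 2" for b c :: nat
      using that by presburger
    ultimately have "y div m = z div m" by blast
    then show ?thesis using less.IH[OF z(2,1) \<open>x \<le> z\<close>] by simp
  qed simp
qed

text \<open>Either \<open>d\<close> exceeds the block length \<open>m\<close>, and then \<open>2 ^ d\<close> exceeds the whole length
  \<open>2 ^ (m + 1)\<close>, or \<open>H\<close> lies in one block and the previous stage applies to its translate.\<close>

lemma block_colour_homogeneous_small:
  assumes "H \<subseteq> {..<tower j}" and "\<forall>x\<in>H. block_colour j x = a" and "gaps_le d H"
  shows "card H \<le> 2 ^ d"
  using assms
proof (induction j arbitrary: H a)
  case 0
  then have "card H \<le> card {..<1::nat}" by (intro card_mono) auto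
  also have "\<dots> \<le> 2 ^ d" by simp
  finally show ?case .
next
  case (Suc j)
  define m where "m = tower j"
  have m: "0 < m" unfolding m_def by (rule tower_pos)
  show ?case
  proof (cases "d \<le> m")
    case False
    have "card H \<le> card {..<tower (Suc j)}" using Suc.prems(1) by (intro card_mono) auto
    also have "\<dots> = 2 ^ (m + 1)" by (simp add: m_def)
    also have "\<dots> \<le> 2 ^ d" using False by (intro power_increasing) auto
    finally show ?thesis .
  next
    case True
    have parity: "\<forall>x\<in>H. (x div m) mod 2 = a mod 2" using Suc.prems(2) by (auto simp: m_def)
    have "x div m = y div m" if "x \<in> H" "y \<in> H" for x y
      using gapped_homogeneous_in_one_block[OF Suc.prems(3) True m parity] that
      by (metis nat_le_linear)
    then obtain b where b: "\<forall>x\<in>H. x div m = b" by metis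
    have dec: "x = b * m + x mod m" if "x \<in> H" for x
      using b that div_mult_mod_eq[of x m] by simp
    have mod_less: "x mod m < y mod m \<longleftrightarrow> x < y" if "x \<in> H" "y \<in> H" for x y
      using dec[OF that(1)] dec[OF that(2)] by linarith
    let ?H = "(\<lambda>x. x mod m) ` H"
    have "inj_on (\<lambda>x. x mod m) H"
      by (rule inj_onI) (metis mod_less nat_neq_iff)
    then have "card H = card ?H" by (simp add: card_image)
    also have "\<dots> \<le> 2 ^ d"
    proof (rule Suc.IH)
      show "?H \<subseteq> {..<tower j}" using m by (auto simp: m_def)
      show "\<forall>x\<in>?H. block_colour j x = a div 2" using Suc.prems(2) by (auto simp: m_def)
      show "gaps_le d ?H"
        unfolding gaps_le_def
      proof (intro ballI impI)
        fix x' y' assume "x' \<in> ?H" "y' \<in> ?H"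
          and *: "x' < y' \<and> (\<forall>z\<in>?H. \<not> (x' < z \<and> z < y'))"
        then obtain x y where xy: "x \<in> H" "y \<in> H" "x' = x mod m" "y' = y mod m" by blast
        have "x < y" using * xy mod_less by blast
        moreover have "\<not> (x < z \<and> z < y)" if "z \<in> H" for z
          using * xy mod_less that by blast
        ultimately have "y \<le> x + d" using Suc.prems(3) xy unfolding gaps_le_def by blast
        then show "y' \<le> x' + d" using dec[OF xy(1)] dec[OF xy(2)] xy(3,4) by linarith
      qed
    qed
    finally show ?thesis .
  qed
qed

section \<open>The standard model\<close>

primrec nval :: "(nat \<Rightarrow> nat) \<Rightarrow> tm \<Rightarrow> nat" where
  "nval e (Var i) = e i"
| "nval e Zero = 0"
| "nval e One = 1"
| "nval e (s \<^bold>+ t) = nval e s + nval e t"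
| "nval e (s \<^bold>* t) = nval e s * nval e t"
| "nval e (s \<^bold>^ t) = nval e s ^ nval e t"

primrec nsat :: "(nat \<Rightarrow> nat) \<Rightarrow> (nat \<Rightarrow> nat set) \<Rightarrow> fm \<Rightarrow> bool" where
  "nsat e S Bot = False"
| "nsat e S (s \<^bold>= t) = (nval e s = nval e t)"
| "nsat e S (s \<^bold>< t) = (nval e s < nval e t)"
| "nsat e S (t \<^bold>\<in> X) = (nval e t \<in> S X)"
| "nsat e S (\<phi> \<^bold>\<longrightarrow> \<psi>) = (nsat e S \<phi> \<longrightarrow> nsat e S \<psi>)"
| "nsat e S (NAll \<phi>) = (\<forall>n. nsat (case_nat n e) S \<phi>)"
| "nsat e S (SAll \<phi>) = (\<forall>A. nsat e (case_nat A S) \<phi>)"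

lemma nval_tsubst: "nval e (tsubst \<sigma> t) = nval (\<lambda>i. nval e (\<sigma> i)) t"
  by (induction t) auto

lemma nval_tlift [simp]: "nval (case_nat n e) (tlift t) = nval e t"
  by (simp add: tlift_def nval_tsubst)

lemma nsat_subst: "nsat e S (subst \<sigma> \<phi>) = nsat (\<lambda>i. nval e (\<sigma> i)) S \<phi>"
proof (induction \<phi> arbitrary: e S \<sigma>)
  case (NAll \<phi>)
  have "(\<lambda>i. nval (case_nat n e) (case_nat (Var 0) (\<lambda>i. tlift (\<sigma> i)) i))
      = case_nat n (\<lambda>i. nval e (\<sigma> i))" for n
    by (rule ext) (simp split: nat.split)
  then show ?case by (simp add: NAll.IH)
qed (simp_all add: nval_tsubst)

lemma nsat_connectives [simp]:
  "nsat e S (\<^bold>\<not> \<phi>) \<longleftrightarrow> \<not> nsat e S \<phi>"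
  "nsat e S (\<phi> \<^bold>\<and> \<psi>) \<longleftrightarrow> nsat e S \<phi> \<and> nsat e S \<psi>"
  "nsat e S (\<phi> \<^bold>\<or> \<psi>) \<longleftrightarrow> nsat e S \<phi> \<or> nsat e S \<psi>"
  "nsat e S (\<phi> \<^bold>\<longleftrightarrow> \<psi>) \<longleftrightarrow> (nsat e S \<phi> \<longleftrightarrow> nsat e S \<psi>)"
  "nsat e S (NEx \<phi>) \<longleftrightarrow> (\<exists>n. nsat (case_nat n e) S \<phi>)"
  "nsat e S (NBAll t \<phi>) \<longleftrightarrow> (\<forall>n<nval e t. nsat (case_nat n e) S \<phi>)"
  "nsat e S (NBEx t \<phi>) \<longleftrightarrow> (\<exists>n<nval e t. nsat (case_nat n e) S \<phi>)"
  by (auto simp: Neg_def Con_def Dis_def Iff_def NEx_def NBAll_def NBEx_def)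

definition npair :: "nat \<Rightarrow> nat \<Rightarrow> nat" where
  "npair i j = (i + j)\<^sup>2 + i"

text \<open>\<open>npair i j\<close> lies between the squares of \<open>i + j\<close> and of \<open>i + j + 1\<close>, hence determines \<open>i + j\<close>.\<close>

lemma npair_inject [simp]: "npair i j = npair i' j' \<longleftrightarrow> i = i' \<and> j = j'"
proof
  assume eq: "npair i j = npair i' j'"
  have square: "npair a b < (a + b + 1)\<^sup>2" "(a + b)\<^sup>2 \<le> npair a b" for a b
    by (simp_all add: npair_def power2_eq_square algebra_simps)
  have "(i + j)\<^sup>2 < (i' + j' + 1)\<^sup>2" "(i' + j')\<^sup>2 < (i + j + 1)\<^sup>2"
    using square eq by (metis le_less_trans)+
  then have "i + j < i' + j' + 1" "i' + j' < i + j + 1"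
    by (metis power_less_imp_less_base zero_le)+
  then have "i + j = i' + j'" by simp
  then show "i = i' \<and> j = j'" using eq by (simp add: npair_def)
qed simp

lemma nval_Two [simp]: "nval e Two = 2"
  by (simp add: Two_def)

lemma nval_pair [simp]: "nval e (pair s t) = npair (nval e s) (nval e t)"
  by (simp add: pair_def npair_def)

lemma set_decode_less: "t \<in> set_decode u \<Longrightarrow> t < u"
proof -
  assume "t \<in> set_decode u"
  then have "odd (u div 2 ^ t)" by (simp add: set_decode_def)
  then have "u div 2 ^ t \<noteq> 0" by (metis even_zero)
  then have "2 ^ t \<le> u" by (metis div_less not_le)
  then show "t < u" using less_le_trans[OF less_exp[of t]] by blast
qed

lemma set_encode_le: "A \<subseteq> {..<b} \<Longrightarrow> set_encode A \<le> 2 ^ b"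
proof -
  assume "A \<subseteq> {..<b}"
  then have "set_encode A \<le> (\<Sum>i<b. 2 ^ i)" unfolding set_encode_def by (intro sum_mono2) auto
  also have "\<dots> \<le> 2 ^ b" by (induction b) auto
  finally show ?thesis .
qed

lemma nsat_elem [simp]: "nsat e S (elem t u) \<longleftrightarrow> nval e t \<in> set_decode (nval e u)"
proof -
  have "(\<exists>q<u. \<exists>s<2 ^ t. u = (2 * q + 1) * 2 ^ t + s) \<longleftrightarrow> odd (u div 2 ^ t)" for t u :: nat
  proof
    assume "odd (u div 2 ^ t)"
    then obtain q where q: "u div 2 ^ t = 2 * q + 1" by (rule oddE)
    have "u = (u div 2 ^ t) * 2 ^ t + u mod 2 ^ t" by (rule div_mult_mod_eq[symmetric])
    then have "u = (2 * q + 1) * 2 ^ t + u mod 2 ^ t" unfolding q .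
    moreover have "u div 2 ^ t \<le> u" by (rule div_le_dividend)
    then have "q < u" using q by simp
    moreover have "u mod 2 ^ t < 2 ^ t" by simp
    ultimately show "\<exists>q<u. \<exists>s<2 ^ t. u = (2 * q + 1) * 2 ^ t + s" by blast
  next
    assume "\<exists>q<u. \<exists>s<2 ^ t. u = (2 * q + 1) * 2 ^ t + s"
    then obtain q s where s: "s < 2 ^ t" and u: "u = (2 * q + 1) * 2 ^ t + s" by blast
    have "u div 2 ^ t = (2 * q + 1) + s div 2 ^ t" unfolding u by (rule div_mult_self3) simp
    then show "odd (u div 2 ^ t)" using s by simp
  qed
  then show ?thesis by (simp add: elem_def set_decode_def eval_nat_numeral)
qed

lemma nsat_AllIn [simp]:
  "nsat e S (AllIn u \<phi>) \<longleftrightarrow> (\<forall>x\<in>set_decode (nval e u). nsat (case_nat x e) S \<phi>)"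
  by (auto simp: AllIn_def dest: set_decode_less)

lemma nsat_ExIn [simp]:
  "nsat e S (ExIn u \<phi>) \<longleftrightarrow> (\<exists>x\<in>set_decode (nval e u). nsat (case_nat x e) S \<phi>)"
  by (auto simp: ExIn_def dest: set_decode_less)

lemma nsat_NBEx1 [simp]:
  "nsat e S (NBEx1 t \<phi>) \<longleftrightarrow> (\<exists>!n. n < nval e t \<and> nsat (case_nat n e) S \<phi>)"
proof -
  have "(\<lambda>i. nval (case_nat y (case_nat x e)) (case_nat (Var 0) (\<lambda>i. Var (Suc (Suc i))) i))
      = case_nat y e" for x y
    by (rule ext) (simp split: nat.split)
  then show ?thesis by (simp add: NBEx1_def nsat_subst) blast
qed

lemma nsat_fin_fun:
  "nsat e S (fin_fun c m r) \<longleftrightarrow>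
    (\<forall>x\<in>set_decode (nval e c). \<exists>i<nval e m. \<exists>j<nval e r. x = npair i j) \<and>
    (\<forall>i<nval e m. \<exists>!j. j < nval e r \<and> npair i j \<in> set_decode (nval e c))"
  by (simp add: fin_fun_def eval_nat_numeral)

lemma nsat_homogeneous:
  "nsat e S (homogeneous c r h) \<longleftrightarrow>
    (\<exists>a<nval e r. \<forall>x\<in>set_decode (nval e h). npair x a \<in> set_decode (nval e c))"
  by (simp add: homogeneous_def)

text \<open>One half of the meaning of \<open>has_card\<close>. It is the half that contradicts the smallness of
  homogeneous sets. Choosing values of the coded bijection gives an
  injection from the numbers below \<open>k\<close> into the set.\<close>

lemma nsat_has_card_le:
  assumes "nsat e S (has_card h k)"
  shows "nval e k \<le> card (set_decode (nval e h))"
proof -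
  let ?H = "set_decode (nval e h)"
  obtain p where f: "\<forall>i<nval e k. \<exists>!j. j < nval e h \<and> npair i j \<in> set_decode p"
    and g: "\<forall>i<nval e k. \<forall>j<nval e h. npair i j \<in> set_decode p \<longrightarrow> j \<in> ?H"
    and u: "\<forall>x\<in>?H. \<exists>!i. i < nval e k \<and> npair i x \<in> set_decode p"
    using assms unfolding has_card_def by (auto simp: nsat_fin_fun eval_nat_numeral)
  from f obtain F where F: "\<forall>i<nval e k. F i < nval e h \<and> npair i (F i) \<in> set_decode p" by metis
  have "F ` {..<nval e k} \<subseteq> ?H" using F g by auto
  moreover have "inj_on F {..<nval e k}"
    by (rule inj_onI) (metis F g u lessThan_iff)
  ultimately show ?thesis using card_inj_on_le[of F "{..<nval e k}" ?H] by simp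
qed

lemma nsat_has_gap_size_le:
  assumes "nsat e S (has_gap_size h g)"
  shows "gaps_le (nval e g) (set_decode (nval e h))"
  using assms unfolding has_gap_size_def gaps_le_def consecutive_def
  by (auto simp: less_Suc_eq_le)

section \<open>Free ultrafilters\<close>

text \<open>By Zorn's lemma there is a minimal proper filter below \<open>F\<close>. It decides every predicate \<open>P\<close>,
  since adding \<open>P\<close> to it either changes nothing or makes it improper.\<close>

lemma ultrafilter_below:
  fixes F :: "'a filter"
  assumes "F \<noteq> bot"
  obtains U where "U \<le> F" "U \<noteq> bot" "\<And>P. eventually P U \<or> eventually (\<lambda>x. \<not> P x) U"
proof -
  let ?A = "{G. G \<le> F \<and> G \<noteq> bot}"
  have "\<exists>m\<in>?A. \<forall>a\<in>?A. a \<le> m \<longrightarrow> a = m"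
  proof (rule predicate_Zorn)
    show "partial_order_on ?A (relation_of (\<lambda>x y. y \<le> x) ?A)"
      by (rule partial_order_on_relation_ofI) auto
    fix C assume C: "C \<in> Chains (relation_of (\<lambda>x y. y \<le> x) ?A)"
    then have sub: "C \<subseteq> ?A" and chain: "\<And>a b. a \<in> C \<Longrightarrow> b \<in> C \<Longrightarrow> a \<le> b \<or> b \<le> a"
      unfolding Chains_def relation_of_def by blast+
    show "\<exists>u\<in>?A. \<forall>a\<in>C. u \<le> a"
    proof (cases "C = {}")
      case False
      have "eventually P (Inf C) \<longleftrightarrow> (\<exists>b\<in>C. eventually P b)" for P
        by (rule eventually_Inf_base[OF False]) (metis chain inf.absorb1 inf.absorb2 order_refl)
      then have "Inf C \<noteq> bot" using sub by (auto simp: trivial_limit_def)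
      moreover have "Inf C \<le> F" using False sub by (metis (no_types, lifting) Inf_lower2 ex_in_conv mem_Collect_eq subset_iff)
      ultimately show ?thesis by (auto intro: Inf_lower)
    qed (use assms in auto)
  qed
  then obtain U where U: "U \<le> F" "U \<noteq> bot" and min: "\<And>G. G \<le> F \<Longrightarrow> G \<noteq> bot \<Longrightarrow> G \<le> U \<Longrightarrow> G = U"
    by auto
  have "eventually P U \<or> eventually (\<lambda>x. \<not> P x) U" for P
  proof (cases "inf U (principal {x. P x}) = bot")
    case True
    then have "eventually (\<lambda>x. \<not> P x) U"
      by (simp add: trivial_limit_def eventually_inf_principal)
    then show ?thesis ..
  next
    case False
    then have "inf U (principal {x. P x}) = U" using U by (intro min) (auto intro: le_infI1)
    then have "U \<le> principal {x. P x}" by (metis inf.cobounded2)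
    then show ?thesis by (simp add: le_principal)
  qed
  with U that show thesis by blast
qed

locale free_ultrafilter =
  fixes U :: "nat filter"
  assumes free: "U \<le> at_top"
    and proper: "U \<noteq> bot"
    and ultra: "eventually P U \<or> eventually (\<lambda>x. \<not> P x) U"
begin

lemma eventually_not: "eventually (\<lambda>x. \<not> P x) U \<longleftrightarrow> \<not> eventually P U"
proof -
  have "\<not> (eventually P U \<and> eventually (\<lambda>x. \<not> P x) U)"
  proof
    assume "eventually P U \<and> eventually (\<lambda>x. \<not> P x) U"
    then have "eventually (\<lambda>x. P x \<and> \<not> P x) U" by (simp only: eventually_conj_iff)
    then show False using proper by (simp add: trivial_limit_def)
  qed
  then show ?thesis using ultra[of P] by blast
qed

lemma eventually_imp: "eventually (\<lambda>x. P x \<longrightarrow> Q x) U \<longleftrightarrow> (eventually P U \<longrightarrow> eventually Q U)"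
proof
  assume "eventually P U \<longrightarrow> eventually Q U"
  then show "eventually (\<lambda>x. P x \<longrightarrow> Q x) U"
    using ultra[of P] by (auto elim: eventually_mono)
qed (auto elim: eventually_mp)

section \<open>The bounded ultrapower\<close>

text \<open>The universe of numbers. Functions are not identified modulo the ultrafilter; instead, equality
  is interpreted as equality almost everywhere, which is a congruence (\<open>usat_cong\<close>). Shifting the
  argument of \<open>tower\<close> by a constant absorbs the arithmetical operations.\<close>

definition tower_bounded :: "(nat \<Rightarrow> nat) set" where
  "tower_bounded = {f. \<exists>k. eventually (\<lambda>x. f x \<le> tower (x + k)) U}"

lemma tower_bounded_le: "f \<in> tower_bounded \<Longrightarrow> eventually (\<lambda>x. g x \<le> f x) U \<Longrightarrow> g \<in> tower_bounded"
  unfolding tower_bounded_def mem_Collect_eq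
  by (elim exE, rule exI, erule (1) eventually_elim2) (rule order_trans)

lemma tower_bounded_const: "(\<lambda>x. c) \<in> tower_bounded"
proof -
  have "c \<le> tower (x + c)" for x
    using le_tower[of c] tower_mono[of c "x + c"] by linarith
  then have "eventually (\<lambda>x. c \<le> tower (x + c)) U" by (intro always_eventually allI)
  then show ?thesis unfolding tower_bounded_def by blast
qed

text \<open>Addition, multiplication and exponentiation increase the height of a tower by at most \<open>1\<close>, \<open>2\<close>
  and \<open>3\<close>.\<close>

lemma tower_bounded_arith:
  assumes "f \<in> tower_bounded" "g \<in> tower_bounded"
  shows "(\<lambda>x. f x + g x) \<in> tower_bounded" "(\<lambda>x. f x * g x) \<in> tower_bounded" "(\<lambda>x. f x ^ g x) \<in> tower_bounded"
proof -
  have add: "a + a \<le> tower (Suc j)" if "a \<le> tower j" for a j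
  proof -
    have "a + a \<le> 2 * 2 ^ tower j" using that less_exp[of "tower j"] by linarith
    then show ?thesis by simp
  qed
  have mul: "a * a \<le> tower (j + 2)" if "a \<le> tower j" for a j
  proof -
    have "a \<le> 2 ^ a" using less_exp[of a] by simp
    then have "a * a \<le> 2 ^ a * 2 ^ a" by (intro mult_mono) auto
    also have "\<dots> = 2 ^ (a + a)" by (simp add: power_add)
    also have "\<dots> \<le> 2 ^ (tower (Suc j) + 1)"
      using add[OF that] by (intro power_increasing) auto
    finally show ?thesis by simp
  qed
  have exp: "a ^ a \<le> tower (j + 3)" if "a \<le> tower j" for a j
  proof -
    have "a \<le> 2 ^ a" using less_exp[of a] by simp
    then have "a ^ a \<le> (2 ^ a) ^ a" by (intro power_mono) auto
    also have "\<dots> = 2 ^ (a * a)" by (simp add: power_mult)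
    also have "\<dots> \<le> 2 ^ (tower (j + 2) + 1)"
      using mul[OF that] by (intro power_increasing) auto
    finally show ?thesis by (simp add: eval_nat_numeral)
  qed
  obtain k l where kl: "eventually (\<lambda>x. f x \<le> tower (x + k)) U" "eventually (\<lambda>x. g x \<le> tower (x + l)) U"
    using assms unfolding tower_bounded_def by blast
  define a where "a = (\<lambda>x. tower (x + max k l))"
  have a_ge: "tower (x + k) \<le> a x" "tower (x + l) \<le> a x" for x
    unfolding a_def by (intro tower_mono; simp)+
  have "eventually (\<lambda>x. f x \<le> a x \<and> g x \<le> a x) U"
    by (intro eventually_conj eventually_mono[OF kl(1)] eventually_mono[OF kl(2)];
        erule order_trans[OF _ a_ge(1)] order_trans[OF _ a_ge(2)])
  then have fa: "eventually (\<lambda>x. f x + g x \<le> a x + a x \<and> f x * g x \<le> a x * a x \<and> f x ^ g x \<le> a x ^ a x) U"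
  proof eventually_elim
    case (elim x)
    have "1 \<le> a x" unfolding a_def using tower_pos[of "x + max k l"] by simp
    then have "f x ^ g x \<le> a x ^ a x"
      using elim by (meson order_trans power_increasing power_mono zero_le)
    then show ?case using elim by (auto intro: add_mono mult_mono)
  qed
  have shift: "h \<in> tower_bounded" if "\<And>x. h x \<le> tower (x + max k l + i)" for h i
    unfolding tower_bounded_def using that by (auto simp: add.assoc intro!: exI[of _ "max k l + i"])
  have "a x + a x \<le> tower (x + max k l + 1)" "a x * a x \<le> tower (x + max k l + 2)"
    "a x ^ a x \<le> tower (x + max k l + 3)" for x
    using add mul exp unfolding a_def by (simp_all del: tower.simps)
  then have a_bounded: "(\<lambda>x. a x + a x) \<in> tower_bounded" "(\<lambda>x. a x * a x) \<in> tower_bounded" "(\<lambda>x. a x ^ a x) \<in> tower_bounded"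
    by (blast intro: shift)+
  show "(\<lambda>x. f x + g x) \<in> tower_bounded"
    by (rule tower_bounded_le[OF a_bounded(1)], rule eventually_mono[OF fa]) blast
  show "(\<lambda>x. f x * g x) \<in> tower_bounded"
    by (rule tower_bounded_le[OF a_bounded(2)], rule eventually_mono[OF fa]) blast
  show "(\<lambda>x. f x ^ g x) \<in> tower_bounded"
    by (rule tower_bounded_le[OF a_bounded(3)], rule eventually_mono[OF fa]) blast
qed

definition assignment :: "(nat \<Rightarrow> nat \<Rightarrow> nat) \<Rightarrow> bool" where
  "assignment e \<longleftrightarrow> (\<forall>i. e i \<in> tower_bounded)"

lemma assignment_case_nat [simp]: "assignment (case_nat f e) \<longleftrightarrow> f \<in> tower_bounded \<and> assignment e"
  unfolding assignment_def by (metis nat.case nat.exhaust)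

definition uval :: "(nat \<Rightarrow> nat \<Rightarrow> nat) \<Rightarrow> tm \<Rightarrow> nat \<Rightarrow> nat" where
  "uval e t = (\<lambda>x. nval (\<lambda>i. e i x) t)"

text \<open>Satisfaction in the model: number quantifiers range over \<open>tower_bounded\<close>, set quantifiers over
  all families of sets indexed by the natural numbers.\<close>

primrec usat :: "(nat \<Rightarrow> nat \<Rightarrow> nat) \<Rightarrow> (nat \<Rightarrow> nat \<Rightarrow> nat set) \<Rightarrow> fm \<Rightarrow> bool" where
  "usat e S Bot = False"
| "usat e S (s \<^bold>= t) = eventually (\<lambda>x. uval e s x = uval e t x) U"
| "usat e S (s \<^bold>< t) = eventually (\<lambda>x. uval e s x < uval e t x) U"
| "usat e S (t \<^bold>\<in> X) = eventually (\<lambda>x. uval e t x \<in> S X x) U"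
| "usat e S (\<phi> \<^bold>\<longrightarrow> \<psi>) = (usat e S \<phi> \<longrightarrow> usat e S \<psi>)"
| "usat e S (NAll \<phi>) = (\<forall>f\<in>tower_bounded. usat (case_nat f e) S \<phi>)"
| "usat e S (SAll \<phi>) = (\<forall>A. usat e (case_nat A S) \<phi>)"

lemma uval_Var [simp]: "uval e (Var i) = e i"
  by (rule ext) (simp add: uval_def)

lemma uval_simps:
  "uval e Zero = (\<lambda>x. 0)"
  "uval e One = (\<lambda>x. 1)"
  "uval e (s \<^bold>+ t) = (\<lambda>x. uval e s x + uval e t x)"
  "uval e (s \<^bold>* t) = (\<lambda>x. uval e s x * uval e t x)"
  "uval e (s \<^bold>^ t) = (\<lambda>x. uval e s x ^ uval e t x)"
  unfolding uval_def by simp_all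

lemma uval_bounded: "assignment e \<Longrightarrow> uval e t \<in> tower_bounded"
proof (induction t)
  case (Var i)
  then show ?case by (simp add: assignment_def)
next
  case Zero
  show ?case unfolding uval_simps by (rule tower_bounded_const)
next
  case One
  show ?case unfolding uval_simps by (rule tower_bounded_const)
next
  case (Add s t)
  then show ?case unfolding uval_simps by (intro tower_bounded_arith(1))
next
  case (Mul s t)
  then show ?case unfolding uval_simps by (intro tower_bounded_arith(2))
next
  case (Exp s t)
  then show ?case unfolding uval_simps by (intro tower_bounded_arith(3))
qed

lemma column_case_nat [simp]: "(\<lambda>i. case_nat f e i x) = case_nat (f x) (\<lambda>i. e i x)"
  by (rule ext) (simp split: nat.split)

lemma uval_tlift [simp]: "uval (case_nat f e) (tlift t) = uval e t"
  by (rule ext) (simp add: uval_def)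

lemma uval_tsubst: "uval e (tsubst \<sigma> t) = uval (\<lambda>i. uval e (\<sigma> i)) t"
  by (rule ext) (simp add: uval_def nval_tsubst)

lemma usat_connectives [simp]:
  "usat e S (\<^bold>\<not> \<phi>) \<longleftrightarrow> \<not> usat e S \<phi>"
  "usat e S (\<phi> \<^bold>\<and> \<psi>) \<longleftrightarrow> usat e S \<phi> \<and> usat e S \<psi>"
  "usat e S (\<phi> \<^bold>\<or> \<psi>) \<longleftrightarrow> usat e S \<phi> \<or> usat e S \<psi>"
  "usat e S (\<phi> \<^bold>\<longleftrightarrow> \<psi>) \<longleftrightarrow> (usat e S \<phi> \<longleftrightarrow> usat e S \<psi>)"
  "usat e S (NEx \<phi>) \<longleftrightarrow> (\<exists>f\<in>tower_bounded. usat (case_nat f e) S \<phi>)"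
  "usat e S (SEx \<phi>) \<longleftrightarrow> (\<exists>A. usat e (case_nat A S) \<phi>)"
  by (auto simp: Neg_def Con_def Dis_def Iff_def NEx_def SEx_def)

lemma usat_subst: "usat e S (subst \<sigma> \<phi>) = usat (\<lambda>i. uval e (\<sigma> i)) S \<phi>"
proof (induction \<phi> arbitrary: e S \<sigma>)
  case (NAll \<phi>)
  have "(\<lambda>i. uval (case_nat f e) (case_nat (Var 0) (\<lambda>i. tlift (\<sigma> i)) i))
      = case_nat f (\<lambda>i. uval e (\<sigma> i))" for f
    by (rule ext) (simp split: nat.split)
  then show ?case by (simp add: NAll.IH)
qed (simp_all add: uval_tsubst)

lemma usat_inst: "usat e S (inst t \<phi>) = usat (case_nat (uval e t) e) S \<phi>"
proof -
  have "(\<lambda>i. uval e (case_nat t Var i)) = case_nat (uval e t) e"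
    by (rule ext) (simp split: nat.split)
  then show ?thesis by (simp add: inst_def usat_subst)
qed

lemma usat_lift: "usat (case_nat f e) S (lift \<phi>) = usat e S \<phi>"
  by (simp add: lift_def usat_subst)

lemma usat_srename: "usat e S (srename \<rho> \<phi>) = usat e (\<lambda>X. S (\<rho> X)) \<phi>"
proof (induction \<phi> arbitrary: e S \<rho>)
  case (SAll \<phi>)
  have "(\<lambda>X. case_nat A S (case_nat 0 (\<lambda>X. Suc (\<rho> X)) X)) = case_nat A (\<lambda>X. S (\<rho> X))" for A
    by (rule ext) (simp split: nat.split)
  then show ?case by (simp add: SAll.IH)
qed simp_all

lemma usat_sinst: "usat e S (sinst X \<phi>) = usat e (case_nat (S X) S) \<phi>"
proof -
  have "(\<lambda>Y. S (case_nat X (\<lambda>Y. Y) Y)) = case_nat (S X) S"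
    by (rule ext) (simp split: nat.split)
  then show ?thesis by (simp add: sinst_def usat_srename)
qed

lemma usat_slift: "usat e (case_nat A S) (slift \<phi>) = usat e S \<phi>"
  by (simp add: slift_def usat_srename)

lemma uval_cong:
  "(\<And>i. eventually (\<lambda>x. e i x = e' i x) U) \<Longrightarrow> eventually (\<lambda>x. uval e t x = uval e' t x) U"
proof (induction t)
  case (Var i)
  then show ?case by simp
qed (auto simp: uval_def elim: eventually_elim2)

lemma usat_cong:
  "(\<And>i. eventually (\<lambda>x. e i x = e' i x) U) \<Longrightarrow> usat e S \<phi> = usat e' S \<phi>"
proof (induction \<phi> arbitrary: e e' S)
  case (Eq s t)
  have "eventually (\<lambda>x. uval e s x = uval e t x \<longleftrightarrow> uval e' s x = uval e' t x) U"
    using uval_cong[where e = e and e' = e' and t = s, OF Eq] uval_cong[where e = e and e' = e' and t = t, OF Eq] by eventually_elim simp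
  then show ?case by (simp add: eventually_subst)
next
  case (Less s t)
  have "eventually (\<lambda>x. uval e s x < uval e t x \<longleftrightarrow> uval e' s x < uval e' t x) U"
    using uval_cong[where e = e and e' = e' and t = s, OF Less] uval_cong[where e = e and e' = e' and t = t, OF Less] by eventually_elim simp
  then show ?case by (simp add: eventually_subst)
next
  case (Mem t X)
  have "eventually (\<lambda>x. uval e t x \<in> S X x \<longleftrightarrow> uval e' t x \<in> S X x) U"
    using uval_cong[where e = e and e' = e' and t = t, OF Mem] by eventually_elim simp
  then show ?case by (simp add: eventually_subst)
next
  case (Imp \<phi> \<psi>)
  then show ?case by (metis usat.simps(5))
next
  case (NAll \<phi>)
  have "usat (case_nat f e) S \<phi> = usat (case_nat f e') S \<phi>" for f
    by (rule NAll.IH) (simp add: NAll.prems split: nat.split)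
  then show ?case by simp
next
  case (SAll \<phi>)
  then show ?case by (metis usat.simps(7))
qed simp

definition valid :: "fm \<Rightarrow> bool" where
  "valid \<phi> \<longleftrightarrow> (\<forall>e S. assignment e \<longrightarrow> usat e S \<phi>)"

lemma logical_axiom_valid: "logical_axiom \<phi> \<Longrightarrow> valid \<phi>"
proof (induction rule: logical_axiom.induct)
  case (9 s t \<phi>)
  have "usat (case_nat (uval e s) e) S \<phi> = usat (case_nat (uval e t) e) S \<phi>"
    if "eventually (\<lambda>x. uval e s x = uval e t x) U" for e S
    by (rule usat_cong) (use that in \<open>simp split: nat.split\<close>)
  then show ?case by (auto simp: valid_def usat_inst)
qed (auto simp: valid_def usat_inst usat_lift usat_sinst usat_slift uval_bounded)

text \<open>The language \<open>L\<close> is arbitrary, so this covers the first-order and the second-order calculus.\<close>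

lemma soundness:
  assumes "provable L T \<phi>" and "\<And>\<psi>. \<psi> \<in> T \<Longrightarrow> valid \<psi>"
  shows "valid \<phi>"
  using assms(1)
proof (induction rule: provable.induct)
  case (Logical \<phi>)
  then show ?case by (simp add: logical_axiom_valid)
next
  case (Axiom \<phi>)
  then show ?case by (simp add: assms(2))
next
  case (MP \<phi> \<psi>)
  then show ?case unfolding valid_def by (metis usat.simps(5))
next
  case (NGen \<phi>)
  then show ?case unfolding valid_def by (metis usat.simps(6) assignment_case_nat)
next
  case (SGen \<phi>)
  then show ?case unfolding valid_def by (metis usat.simps(7))
qed

section \<open>Transfer of bounded formulas\<close>

text \<open>The statement of Los's theorem for \<open>\<phi>\<close>. As a property of formulas it can be
  established compositionally, and closure under substitution comes for free.\<close>

definition transfers :: "fm \<Rightarrow> bool" where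
  "transfers \<phi> \<longleftrightarrow> (\<forall>e S. assignment e \<longrightarrow>
    (usat e S \<phi> \<longleftrightarrow> eventually (\<lambda>x. nsat (\<lambda>i. e i x) (\<lambda>X. S X x) \<phi>) U))"

lemma transfersD:
  "transfers \<phi> \<Longrightarrow> assignment e \<Longrightarrow>
    usat e S \<phi> \<longleftrightarrow> eventually (\<lambda>x. nsat (\<lambda>i. e i x) (\<lambda>X. S X x) \<phi>) U"
  unfolding transfers_def by blast

named_theorems transfers

lemma transfers_atoms [transfers]:
  "transfers Bot" "transfers (s \<^bold>= t)" "transfers (s \<^bold>< t)" "transfers (t \<^bold>\<in> X)"
  using proper by (auto simp: transfers_def uval_def trivial_limit_def)

lemma transfers_Imp [transfers]: "transfers \<phi> \<Longrightarrow> transfers \<psi> \<Longrightarrow> transfers (\<phi> \<^bold>\<longrightarrow> \<psi>)"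
  by (simp add: transfers_def eventually_imp)

lemma transfers_connectives [transfers]:
  "transfers \<phi> \<Longrightarrow> transfers (\<^bold>\<not> \<phi>)"
  "transfers \<phi> \<Longrightarrow> transfers \<psi> \<Longrightarrow> transfers (\<phi> \<^bold>\<and> \<psi>)"
  "transfers \<phi> \<Longrightarrow> transfers \<psi> \<Longrightarrow> transfers (\<phi> \<^bold>\<or> \<psi>)"
  "transfers \<phi> \<Longrightarrow> transfers \<psi> \<Longrightarrow> transfers (\<phi> \<^bold>\<longleftrightarrow> \<psi>)"
  unfolding Neg_def Con_def Dis_def Iff_def by (intro transfers_atoms transfers_Imp; assumption)+

lemma transfers_subst [transfers]: "transfers \<phi> \<Longrightarrow> transfers (subst \<sigma> \<phi>)"
  unfolding transfers_def
proof (intro allI impI)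
  fix e S assume tr: "\<forall>e S. assignment e \<longrightarrow>
    (usat e S \<phi> \<longleftrightarrow> eventually (\<lambda>x. nsat (\<lambda>i. e i x) (\<lambda>X. S X x) \<phi>) U)" and "assignment e"
  then have "assignment (\<lambda>i. uval e (\<sigma> i))" by (simp add: assignment_def uval_bounded)
  with tr show "usat e S (subst \<sigma> \<phi>)
      \<longleftrightarrow> eventually (\<lambda>x. nsat (\<lambda>i. e i x) (\<lambda>X. S X x) (subst \<sigma> \<phi>)) U"
    unfolding usat_subst nsat_subst by (simp add: uval_def)
qed

text \<open>Witnesses at the single indices are put together by choice. The resulting function is below the
  value of the bounding term, hence belongs to the model.\<close>

lemma transfers_NBEx [transfers]:
  assumes "transfers \<phi>"
  shows "transfers (NBEx t \<phi>)"
  unfolding transfers_def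
proof (intro allI impI)
  fix e S assume e: "assignment e"
  let ?P = "\<lambda>x n. n < uval e t x \<and> nsat (case_nat n (\<lambda>i. e i x)) (\<lambda>X. S X x) \<phi>"
  have "usat e S (NBEx t \<phi>) \<longleftrightarrow> (\<exists>f\<in>tower_bounded. eventually (\<lambda>x. ?P x (f x)) U)"
    using e by (simp add: NBEx_def transfersD[OF assms] eventually_conj_iff)
  also have "\<dots> \<longleftrightarrow> eventually (\<lambda>x. \<exists>n. ?P x n) U"
  proof
    assume ev: "eventually (\<lambda>x. \<exists>n. ?P x n) U"
    define f where "f = (\<lambda>x. SOME n. ?P x n)"
    have f: "eventually (\<lambda>x. ?P x (f x)) U"
      using ev unfolding f_def by eventually_elim (rule someI_ex)
    then have "f \<in> tower_bounded"
      by (intro tower_bounded_le[OF uval_bounded[OF e, of t]]) (auto elim: eventually_mono)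
    with f show "\<exists>f\<in>tower_bounded. eventually (\<lambda>x. ?P x (f x)) U" by blast
  qed (blast intro: eventually_mono)
  finally show "usat e S (NBEx t \<phi>)
      \<longleftrightarrow> eventually (\<lambda>x. nsat (\<lambda>i. e i x) (\<lambda>X. S X x) (NBEx t \<phi>)) U"
    by (simp add: uval_def)
qed

lemma transfers_NBAll [transfers]:
  assumes "transfers \<phi>"
  shows "transfers (NBAll t \<phi>)"
proof -
  have "usat e S (NBAll t \<phi>) = usat e S (\<^bold>\<not> NBEx t (\<^bold>\<not> \<phi>))"
    and "nsat d R (NBAll t \<phi>) = nsat d R (\<^bold>\<not> NBEx t (\<^bold>\<not> \<phi>))" for e S d R
    by (auto simp: NBAll_def NBEx_def)
  moreover have "transfers (\<^bold>\<not> NBEx t (\<^bold>\<not> \<phi>))"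
    by (intro transfers_connectives transfers_NBEx assms)
  ultimately show ?thesis unfolding transfers_def by presburger
qed

lemma sigma00_transfers: "sigma00 \<phi> \<Longrightarrow> transfers \<phi>"
  by (induction rule: sigma00.induct) (intro transfers; assumption)+

text \<open>Witnesses of an unbounded quantifier at the single indices may grow too fast, so only this
  direction survives for existential formulas.\<close>

lemma usat_NEx_imp_eventually_nsat:
  assumes "transfers \<phi>" "assignment e" "usat e S (NEx \<phi>)"
  shows "eventually (\<lambda>x. nsat (\<lambda>i. e i x) (\<lambda>X. S X x) (NEx \<phi>)) U"
proof -
  obtain f where "f \<in> tower_bounded" "usat (case_nat f e) S \<phi>" using assms(3) by auto
  then have "eventually (\<lambda>x. nsat (case_nat (f x) (\<lambda>i. e i x)) (\<lambda>X. S X x) \<phi>) U"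
    using assms by (simp add: transfersD)
  then show ?thesis by eventually_elim auto
qed

lemma transfers_coding [transfers]:
  "transfers (elem t u)"
  "transfers \<phi> \<Longrightarrow> transfers (AllIn u \<phi>)"
  "transfers \<phi> \<Longrightarrow> transfers (ExIn u \<phi>)"
  "transfers \<phi> \<Longrightarrow> transfers (NBEx1 t \<phi>)"
  unfolding elem_def AllIn_def ExIn_def NBEx1_def by (intro transfers; assumption)+

lemma transfers_combinatorics [transfers]:
  "transfers (fin_fun c m r)"
  "transfers (fin_subset h n)"
  "transfers (consecutive h s t)"
  "transfers (has_gap_size h g)"
  "transfers (homogeneous c r h)"
  unfolding fin_fun_def fin_subset_def consecutive_def has_gap_size_def homogeneous_def
  by (intro transfers)+

section \<open>The bounded ultrapower is a model\<close>

lemma basic_axioms_valid: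
  assumes "\<phi> \<in> basic_axioms"
  shows "valid \<phi>"
proof -
  have "transfers \<phi>" using assms unfolding basic_axioms_def by (auto intro!: transfers)
  moreover have "nsat e S \<phi>" for e S
    using assms unfolding basic_axioms_def by (auto simp: less_Suc_eq)
  ultimately show ?thesis unfolding valid_def by (simp add: transfersD)
qed

text \<open>If \<open>\<phi>\<close> fails at \<open>f\<close>, then at almost all indices \<open>x\<close> there is a least failure, which is at most
  \<open>f x\<close> and not \<open>0\<close>. The predecessors of these failures form an element of the model that refutes
  the induction step.\<close>

lemma induction_axiom_valid:
  assumes "sigma00 \<phi>"
  shows "valid (induction_axiom \<phi>)"
  unfolding valid_def
proof (intro allI impI)
  fix e S assume e: "assignment e"
  note tr = transfersD[OF sigma00_transfers[OF assms]]
  let ?P = "\<lambda>x n. nsat (case_nat n (\<lambda>i. e i x)) (\<lambda>X. S X x) \<phi>"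
  have succ: "usat (case_nat f e) S (subst (case_nat (Var 0 \<^bold>+ One) (\<lambda>i. Var (Suc i))) \<phi>)
      = eventually (\<lambda>x. ?P x (f x + 1)) U" if "f \<in> tower_bounded" for f
  proof -
    have *: "(\<lambda>i. uval (case_nat f e) (case_nat (Var 0 \<^bold>+ One) (\<lambda>i. Var (Suc i)) i))
        = case_nat (\<lambda>x. f x + 1) e"
      by (intro ext) (simp add: uval_def split: nat.split)
    show ?thesis using that e by (simp add: usat_subst * tr tower_bounded_arith tower_bounded_const del: One_nat_def)
  qed
  have "eventually (\<lambda>x. ?P x (f x)) U"
    if zero: "eventually (\<lambda>x. ?P x 0) U"
      and step: "\<And>g. g \<in> tower_bounded \<Longrightarrow> eventually (\<lambda>x. ?P x (g x)) U \<Longrightarrow> eventually (\<lambda>x. ?P x (g x + 1)) U"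
      and "f \<in> tower_bounded" for f
  proof (rule ccontr)
    assume "\<not> eventually (\<lambda>x. ?P x (f x)) U"
    then have neg: "eventually (\<lambda>x. \<not> ?P x (f x)) U" by (simp add: eventually_not)
    define g where "g = (\<lambda>x. (LEAST n. \<not> ?P x n) - 1)"
    have g: "eventually (\<lambda>x. g x \<le> f x \<and> ?P x (g x) \<and> \<not> ?P x (g x + 1)) U"
      using zero neg
    proof eventually_elim
      case (elim x)
      let ?l = "LEAST n. \<not> ?P x n"
      have l: "\<not> ?P x ?l" using elim(2) by (rule LeastI)
      then have "?l \<noteq> 0" using elim(1) by metis
      then have "g x < ?l" "g x + 1 = ?l" unfolding g_def by simp_all
      moreover have "?l \<le> f x" using elim(2) by (rule Least_le)
      ultimately show ?case using l not_less_Least[of "g x"] by (metis less_imp_le order_trans)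
    qed
    then have "g \<in> tower_bounded" by (intro tower_bounded_le[OF \<open>f \<in> tower_bounded\<close>]) (auto elim: eventually_mono)
    then have "eventually (\<lambda>x. ?P x (g x + 1)) U" using g by (intro step) (auto elim: eventually_mono)
    moreover have "\<not> eventually (\<lambda>x. ?P x (g x + 1)) U"
      using g by (subst eventually_not[symmetric]) (auto elim: eventually_mono)
    ultimately show False by contradiction
  qed
  then show "usat e S (induction_axiom \<phi>)"
    using e by (simp add: induction_axiom_def usat_inst succ tr tower_bounded_const uval_def)
qed

text \<open>Let \<open>\<exists>y \<theta>(n, y)\<close> and \<open>\<forall>y \<eta>(n, y)\<close> be equivalent in the model. At each index \<open>x\<close> put \<open>n\<close>
  into \<open>A x\<close> iff some \<open>y\<close> with \<open>\<theta>(n, y)\<close> comes no later than every counterexample to \<open>\<eta>(n, y)\<close>.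
  For each \<open>n\<close> of the model, a witness of \<open>\<theta>\<close> or a counterexample to \<open>\<eta>\<close> exists in the model, so
  whichever comes first is found below it and thus again in the model. Hence the unbounded search in
  the definition of \<open>A\<close>, which is carried out in the standard model, gives the right answer.\<close>

lemma comprehension_axiom_valid:
  assumes "sigma01 \<phi>" "pi01 \<psi>"
  shows "valid (comprehension_axiom \<phi> \<psi>)"
  unfolding valid_def
proof (intro allI impI)
  fix e S assume e: "assignment e"
  obtain \<theta> \<eta> where \<theta>: "sigma00 \<theta>" "\<phi> = NEx \<theta>" and \<eta>: "sigma00 \<eta>" "\<psi> = NAll \<eta>"
    using assms unfolding sigma01_def pi01_def by blast
  let ?\<theta> = "\<lambda>x n y. nsat (case_nat y (case_nat n (\<lambda>i. e i x))) (\<lambda>X. S X x) \<theta>"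
  let ?\<eta> = "\<lambda>x n y. nsat (case_nat y (case_nat n (\<lambda>i. e i x))) (\<lambda>X. S X x) \<eta>"
  define A where "A = (\<lambda>x. {n. \<exists>y. ?\<theta> x n y \<and> (\<forall>z<y. ?\<eta> x n z)})"
  have \<phi>: "usat (case_nat f e) S \<phi> \<longleftrightarrow> (\<exists>g\<in>tower_bounded. eventually (\<lambda>x. ?\<theta> x (f x) (g x)) U)"
    and \<psi>: "usat (case_nat f e) S \<psi> \<longleftrightarrow> (\<forall>g\<in>tower_bounded. eventually (\<lambda>x. ?\<eta> x (f x) (g x)) U)"
    if "f \<in> tower_bounded" for f
    using that e by (simp_all add: \<theta> \<eta> transfersD sigma00_transfers)
  have "eventually (\<lambda>x. f x \<in> A x) U \<longleftrightarrow> usat (case_nat f e) S \<phi>"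
    if f: "f \<in> tower_bounded" and iff: "usat (case_nat f e) S \<phi> \<longleftrightarrow> usat (case_nat f e) S \<psi>" for f
  proof (cases "usat (case_nat f e) S \<phi>")
    case True
    then obtain g where g: "g \<in> tower_bounded" "eventually (\<lambda>x. ?\<theta> x (f x) (g x)) U" using \<phi>[OF f] by blast
    \<comment> \<open>The first counterexample to \<open>\<eta>\<close>, cut off at the witness \<open>g x\<close> of \<open>\<theta>\<close>.\<close>
    define h where "h = (\<lambda>x. LEAST z. \<not> ?\<eta> x (f x) z \<or> z = g x)"
    have "h x \<le> g x" for x unfolding h_def by (rule Least_le) simp
    then have "h \<in> tower_bounded" by (intro tower_bounded_le[OF g(1)]) simp
    then have "eventually (\<lambda>x. ?\<eta> x (f x) (h x)) U" using True iff \<psi>[OF f] by blast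
    then have "eventually (\<lambda>x. f x \<in> A x) U" using g(2)
    proof eventually_elim
      case (elim x)
      have "\<not> ?\<eta> x (f x) (h x) \<or> h x = g x" unfolding h_def by (rule LeastI[of _ "g x"]) simp
      then have "h x = g x" using elim by simp
      moreover have "?\<eta> x (f x) z" if "z < h x" for z
        using that not_less_Least unfolding h_def by blast
      ultimately show ?case using elim(2) unfolding A_def by auto
    qed
    with True show ?thesis by simp
  next
    case False
    then obtain g where g: "g \<in> tower_bounded" "\<not> eventually (\<lambda>x. ?\<eta> x (f x) (g x)) U"
      using iff \<psi>[OF f] by blast
    have "\<not> eventually (\<lambda>x. f x \<in> A x) U"
    proof
      assume A: "eventually (\<lambda>x. f x \<in> A x) U"
      \<comment> \<open>The counterexample \<open>g\<close> to \<open>\<eta>\<close> bounds the witness that puts \<open>f x\<close> into \<open>A x\<close>.\<close>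
      define h where "h = (\<lambda>x. SOME y. ?\<theta> x (f x) y \<and> (\<forall>z<y. ?\<eta> x (f x) z))"
      have "eventually (\<lambda>x. ?\<theta> x (f x) (h x) \<and> (\<forall>z<h x. ?\<eta> x (f x) z)) U"
        using A unfolding A_def h_def by eventually_elim (rule someI_ex, simp)
      moreover have "eventually (\<lambda>x. \<not> ?\<eta> x (f x) (g x)) U" using g by (simp add: eventually_not)
      ultimately have h: "eventually (\<lambda>x. ?\<theta> x (f x) (h x) \<and> h x \<le> g x) U"
        by eventually_elim (metis not_le)
      then have "h \<in> tower_bounded" by (intro tower_bounded_le[OF g(1)]) (auto elim: eventually_mono)
      moreover have "eventually (\<lambda>x. ?\<theta> x (f x) (h x)) U" using h by (auto elim: eventually_mono)
      ultimately show False using False \<phi>[OF f] by blast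
    qed
    with False show ?thesis by simp
  qed
  then show "usat e S (comprehension_axiom \<phi> \<psi>)"
    unfolding comprehension_axiom_def by (auto simp: usat_slift intro!: exI[of _ A])
qed

lemma RCA0_star_valid: "\<phi> \<in> RCA0_star \<Longrightarrow> valid \<phi>"
  unfolding RCA0_star_def
  using basic_axioms_valid induction_axiom_valid comprehension_axiom_valid by auto

section \<open>Failure of Brown's lemma\<close>

text \<open>The argument only uses that \<open>f_less d k\<close>, if true in the model, implies \<open>2 ^ d < k\<close> at almost
  all indices. This makes it applicable both to \<open>BL_exp2\<close> and to the instance of \<open>finite_brown\<close> at
  the graph of \<open>d \<mapsto> 2 ^ d\<close>. For a given \<open>n\<close>, the colouring used at index \<open>x\<close> is the restriction of
  \<open>block_colour (2x)\<close> to \<open>n x\<close>; its code is bounded by a term in \<open>n\<close> and \<open>r\<close>.\<close>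

lemma BL_fails:
  assumes growth: "\<And>e. assignment e \<Longrightarrow> usat e S (f_less (Var 0) (Var 1)) \<Longrightarrow>
      eventually (\<lambda>x. 2 ^ e 0 x < e 1 x) U"
    and e: "assignment e"
  shows "\<not> usat e S (BL f_less)"
proof
  assume BL: "usat e S (BL f_less)"
  define r :: "nat \<Rightarrow> nat" where "r = (\<lambda>x. 2 ^ (x + x))"
  have id: "(\<lambda>x. x) \<in> tower_bounded" unfolding tower_bounded_def using le_tower by (auto intro!: exI[of _ 0])
  have r: "r \<in> tower_bounded" unfolding r_def by (intro tower_bounded_arith tower_bounded_const id)
  have "eventually (\<lambda>x. 0 < r x) U" by (simp add: r_def)
  then obtain n where n: "n \<in> tower_bounded"
    and BL_n: "\<And>C. C \<in> tower_bounded \<Longrightarrow>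
      usat (case_nat C (case_nat n (case_nat r e))) S (fin_fun (Var 0) (Var 1) (Var 2)) \<Longrightarrow>
      \<exists>H\<in>tower_bounded. let e' = case_nat H (case_nat C (case_nat n (case_nat r e))) in
        usat e' S (fin_subset (Var 0) (Var 2)) \<and> usat e' S (homogeneous (Var 1) (Var 3) (Var 0)) \<and>
        (\<exists>k\<in>tower_bounded. \<exists>g\<in>tower_bounded. usat (case_nat g (case_nat k e')) S (has_card (Var 2) (Var 1)) \<and>
          usat (case_nat g (case_nat k e')) S (has_gap_size (Var 2) (Var 0)) \<and>
          usat (case_nat g (case_nat k e')) S (f_less (Var 0) (Var 1)))"
    using BL r unfolding BL_def by (fastforce simp: Let_def uval_def)
  define G where "G = (\<lambda>x. (\<lambda>i. npair i (block_colour (x + x) i)) ` {..<n x})"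
  define C where "C = (\<lambda>x. set_encode (G x))"
  have C_decode: "set_decode (C x) = G x" for x
    unfolding C_def by (rule set_encode_inverse) (simp add: G_def)
  let ?e4 = "\<lambda>H. case_nat H (case_nat C (case_nat n (case_nat r e)))"
  let ?e6 = "\<lambda>H k g. case_nat g (case_nat k (?e4 H))"
  have "C \<in> tower_bounded"
  proof (rule tower_bounded_le)
    show "(\<lambda>x. 2 ^ (npair (n x) (r x))) \<in> tower_bounded"
      unfolding npair_def by (intro tower_bounded_arith tower_bounded_const n r)
    have "G x \<subseteq> {..<npair (n x) (r x)}" for x
    proof
      fix z assume "z \<in> G x"
      then obtain i where i: "i < n x" "z = npair i (block_colour (x + x) i)" by (auto simp: G_def)
      moreover have "block_colour (x + x) i < r x" unfolding r_def by (rule block_colour_less)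
      ultimately show "z \<in> {..<npair (n x) (r x)}"
        unfolding npair_def by (auto intro!: add_le_less_mono power_mono)
    qed
    then show "eventually (\<lambda>x. C x \<le> 2 ^ (npair (n x) (r x))) U"
      unfolding C_def by (intro always_eventually allI set_encode_le)
  qed
  moreover have "usat (case_nat C (case_nat n (case_nat r e))) S (fin_fun (Var 0) (Var 1) (Var 2))"
    using \<open>C \<in> tower_bounded\<close> n r e block_colour_less
    by (auto simp: transfersD transfers nsat_fin_fun eval_nat_numeral C_decode G_def r_def
      intro!: always_eventually)
  ultimately obtain H k g where tower_bounded: "H \<in> tower_bounded" "k \<in> tower_bounded" "g \<in> tower_bounded" and H:
    "usat (?e4 H) S (fin_subset (Var 0) (Var 2))"
    "usat (?e4 H) S (homogeneous (Var 1) (Var 3) (Var 0))"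
    and kg:
    "usat (?e6 H k g) S (has_card (Var 2) (Var 1))"
    "usat (?e6 H k g) S (has_gap_size (Var 2) (Var 0))"
    "usat (?e6 H k g) S (f_less (Var 0) (Var 1))"
    using BL_n unfolding Let_def by blast
  have asg: "assignment (?e6 H k g)"
    using tower_bounded \<open>C \<in> tower_bounded\<close> n r e by simp
  have sub: "eventually (\<lambda>x. \<forall>z\<in>set_decode (H x). z < n x) U"
    and hom: "eventually (\<lambda>x. \<exists>a<r x. \<forall>z\<in>set_decode (H x). npair z a \<in> G x) U"
    using H asg by (simp_all add: transfersD transfers nsat_homogeneous fin_subset_def
        eval_nat_numeral C_decode)
  have "eventually (\<lambda>x. nsat (\<lambda>i. ?e6 H k g i x) (\<lambda>X. S X x) (has_card (Var 2) (Var 1))) U"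
    using usat_NEx_imp_eventually_nsat[OF _ asg kg(1)[unfolded has_card_def]]
    unfolding has_card_def by (simp add: transfers)
  then have card: "eventually (\<lambda>x. k x \<le> card (set_decode (H x))) U"
    by eventually_elim (drule nsat_has_card_le, simp add: eval_nat_numeral)
  have "eventually (\<lambda>x. nsat (\<lambda>i. ?e6 H k g i x) (\<lambda>X. S X x) (has_gap_size (Var 2) (Var 0))) U"
    using kg(2) asg by (simp add: transfersD transfers)
  then have gaps: "eventually (\<lambda>x. gaps_le (g x) (set_decode (H x))) U"
    by eventually_elim (drule nsat_has_gap_size_le, simp add: eval_nat_numeral)
  have less: "eventually (\<lambda>x. 2 ^ g x < k x) U" using growth[OF asg kg(3)] by simp
  obtain l where "eventually (\<lambda>x. n x \<le> tower (x + l)) U" using n unfolding tower_bounded_def by blast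
  \<comment> \<open>The constant \<open>l\<close> is absorbed because the ultrafilter is free.\<close>
  moreover have "eventually (\<lambda>x. l \<le> x) U" using free eventually_ge_at_top filter_leD by blast
  ultimately have n_le: "eventually (\<lambda>x. n x \<le> tower (x + x)) U"
    by eventually_elim (meson add_left_mono order_trans tower_mono)
  have "eventually (\<lambda>x. False) U"
    using sub hom card gaps less n_le
  proof eventually_elim
    case (elim x)
    obtain a where a: "\<forall>z\<in>set_decode (H x). npair z a \<in> G x" using elim(2) by blast
    have "card (set_decode (H x)) \<le> 2 ^ g x"
    proof (rule block_colour_homogeneous_small)
      show "set_decode (H x) \<subseteq> {..<tower (x + x)}" using elim(1,6) by fastforce
      show "\<forall>z\<in>set_decode (H x). block_colour (x + x) z = a" using a by (auto simp: G_def)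
    qed (rule elim(4))
    with elim(3,5) show False by simp
  qed
  then show False using proper by (simp add: trivial_limit_def)
qed

lemma not_valid_BL_exp2: "\<not> valid BL_exp2"
proof -
  have "\<not> usat (\<lambda>i x. 0) S BL_exp2" for S
    unfolding BL_exp2_def
    by (rule BL_fails) (auto simp: uval_def assignment_def tower_bounded_const)
  moreover have "assignment (\<lambda>i x. 0)" by (simp add: assignment_def tower_bounded_const)
  ultimately show ?thesis unfolding valid_def by blast
qed

text \<open>The graph of \<open>d \<mapsto> 2 ^ d\<close>, taken at every index, is a set of the model, and it is a function
  there because the universe is closed under exponentiation.\<close>

lemma not_valid_finite_brown: "\<not> valid finite_brown"
proof
  assume "valid finite_brown"
  let ?e = "\<lambda>(i::nat) (x::nat). 0::nat"
  define X :: "nat \<Rightarrow> nat set" where "X = (\<lambda>x. range (\<lambda>d. npair d (2 ^ d)))"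
  define S :: "nat \<Rightarrow> nat \<Rightarrow> nat set" where "S = case_nat X (\<lambda>i x. {})"
  have e: "assignment ?e" by (auto simp: assignment_def tower_bounded_const)
  have "usat ?e S (is_function 0)"
  proof -
    have "\<exists>f\<in>tower_bounded. \<exists>g\<in>tower_bounded. eventually (\<lambda>x. h x = npair (f x) (g x)) U"
      if h: "h \<in> tower_bounded" and ev: "eventually (\<lambda>x. h x \<in> X x) U" for h
    proof -
      define f where "f = (\<lambda>x. SOME d. h x = npair d (2 ^ d))"
      have f: "eventually (\<lambda>x. h x = npair (f x) (2 ^ f x)) U"
        using ev unfolding f_def X_def by eventually_elim (rule someI_ex, auto)
      have "f \<in> tower_bounded"
        by (rule tower_bounded_le[OF h]) (use f in \<open>auto elim!: eventually_mono simp: npair_def\<close>)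
      with f show ?thesis
        by (intro bexI[of _ f] bexI[of _ "\<lambda>x. 2 ^ f x"]) (auto intro: tower_bounded_arith tower_bounded_const)
    qed
    moreover have "\<exists>g\<in>tower_bounded. eventually (\<lambda>x. npair (f x) (g x) \<in> X x) U \<and>
        (\<forall>h\<in>tower_bounded. eventually (\<lambda>x. npair (f x) (h x) \<in> X x) U \<longrightarrow> eventually (\<lambda>x. h x = g x) U)"
      if "f \<in> tower_bounded" for f
      by (rule bexI[of _ "\<lambda>x. 2 ^ f x"])
        (auto simp: X_def intro: tower_bounded_arith tower_bounded_const that elim: eventually_mono)
    ultimately show ?thesis
      by (simp add: is_function_def S_def eval_nat_numeral uval_def)
  qed
  then have "usat ?e S (BL (\<lambda>d k. NEx (pair (tlift d) (Var 0) \<^bold>\<in> 0 \<^bold>\<and> Var 0 \<^bold>< tlift k)))"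
    using \<open>valid finite_brown\<close> e unfolding valid_def finite_brown_def S_def by auto
  moreover have "\<not> usat ?e S (BL (\<lambda>d k. NEx (pair (tlift d) (Var 0) \<^bold>\<in> 0 \<^bold>\<and> Var 0 \<^bold>< tlift k)))"
  proof (rule BL_fails[OF _ e])
    fix e assume "assignment e"
      and "usat e S (NEx (pair (tlift (Var 0)) (Var 0) \<^bold>\<in> 0 \<^bold>\<and> Var 0 \<^bold>< tlift (Var 1)))"
    then have "eventually (\<lambda>x. nsat (\<lambda>i. e i x) (\<lambda>X. S X x)
        (NEx (pair (tlift (Var 0)) (Var 0) \<^bold>\<in> 0 \<^bold>\<and> Var 0 \<^bold>< tlift (Var 1)))) U"
      by (intro usat_NEx_imp_eventually_nsat transfers)
    then show "eventually (\<lambda>x. 2 ^ e 0 x < e 1 x) U"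
      by eventually_elim (auto simp: S_def X_def)
  qed
  ultimately show False by contradiction
qed

end

theorem corollary6p8:
  shows "\<not> EFA_proves BL_exp2 \<and> \<not> RCA0_star_proves finite_brown"
proof -
  have "at_top \<noteq> (bot :: nat filter)" by (rule sequentially_bot)
  then obtain U :: "nat filter" where "free_ultrafilter U"
    by (rule ultrafilter_below) (blast intro: free_ultrafilter.intro)
  then interpret free_ultrafilter U .
  have "EFA \<subseteq> RCA0_star" unfolding EFA_def RCA0_star_def by blast
  then have "EFA_proves \<phi> \<Longrightarrow> valid \<phi>" "RCA0_star_proves \<phi> \<Longrightarrow> valid \<phi>" for \<phi>
    unfolding EFA_proves_def RCA0_star_proves_def by (auto elim!: soundness intro: RCA0_star_valid)
  then show ?thesis using not_valid_BL_exp2 not_valid_finite_brown by blast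
qed

end
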